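(* Let $S$ be a Banach space with a normalized basis $(s_j)_{j=1}^\infty$ whose normalized associated coordinate functionals $(s_j^* )_{j=1}^\infty$ form a subsymmetric weak$^*$ Schauder basis of $S^*$, and assume that $S^*$ together with $(s_j^* )_{j=1}^\infty$ satisfies condition (C). Then for every bounded linear operator $T : S^*\to S^*$ there exist bounded linear operators $M, N : S^*\to S^*$ such that, for $H = T$ or for $H = \mathrm{Id}_{S^*}-T$, $$ N H M = \mathrm{Id}_{S^*} \qquad\text{and}\qquad \|M\|\,\|N\| \le 48 K_u^7 K_s^4 .$$ Consequently, $H(S^* )$ contains a subspace which is isomorphic to $S^*$ and complemented in $S^*$.
   Context: Weak$^*$ Schauder basis: for a Banach space $X$ with a basis $(e_j)$, the associated coordinate functionals $(e_j^* )\subset X^*$ (so $\langle e_j^*,e_i\rangle=\delta_{ij}$) form a weak$^*$ Schauder basis of $X^*$ if every $x^*\in X^*$ satisfies $x^* = \text{weak}^*\text{-}\lim_{n\to\infty}\sum_{j=1}^n \langle x^*,e_j\rangle e_j^*$. All series in $X^*$ are understood as weak$^*$ limits of partial sums. Unconditional: there is $C\ge1$ with $\|\sum_j \gamma_j a_j e_j^*\| \le C\sup_j|\gamma_j|\,\|\sum_j a_je_j^*\|$ for all $(\gamma_j)\in\ell^\infty$ and all scalars $(a_j)$ with $\sum_j a_je_j^*\in X^*$; $K_u$ is the infimum of such $C$. Subsymmetric: $(e_j^* )$ is unconditional and, for every increasing sequence $(n_j)\subset\mathbb{N}$, the operator $S_{(n_j)}(\sum_j a_je_j^* ) = \sum_j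 a_j e_{n_j}^*$ is an isomorphism of $X^*$ onto the weak$^*$-closed span of $\{e_{n_j}^*\}$; $K_s = \sup\{\|S_{(n_j)}\|,\|S_{(n_j)}^{-1}\|\}$ over all increasing sequences (which is finite). Condition (C): Let $U$ be a Banach space with normalized unconditional basis $(e_j)$ whose normalized coordinate functionals $(e_j^* )$ form an unconditional weak$^*$ Schauder basis of $U^*$. For $\mathcal{A}\subset\mathbb{N}$ let $P_{\mathcal{A}}(\sum_j a_je_j^* ) = \sum_{j\in\mathcal{A}} a_je_j^*$. $U^*$ with $(e_j^* )$ satisfies condition (C) if for every infinite $\Lambda\subset\mathbb{N}$ and every $\theta>0$ there is a sequence $(\mathcal{A}_j)_{j\ge1}$ of pairwise disjoint infinite subsets of $\Lambda$ such that for every sequence $(x_j^* )\subset U^*$ with $\|x_j^*\|\le1$ there exist scalars $(a_j)\in\ell^1$ with $\|(a_j)\|_{\ell^1}=1$ and $\|\sum_{j=1}^\infty a_jP_{\mathcal{A}_j}x_j^*\|_{U^*}\le\theta$ (the series converging weak$^*$). *)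

theory Defs
  imports "HOL-Analysis.Analysis"
begin

(* Real Banach space X (type 'a), its dual Xdual = 'a =>L real.
  e : basis of X,  es : coordinate functionals (elements of Xdual). *)

definition schauder_basis :: "(nat \<Rightarrow> 'a::banach) \<Rightarrow> bool" where
  "schauder_basis e \<longleftrightarrow> (\<forall>x. \<exists>!a. (\<lambda>n. \<Sum>j<n. a j *\<^sub>R e j) \<longlonglongrightarrow> x)"

definition wstar_sums :: "(nat \<Rightarrow> ('a::banach \<Rightarrow>\<^sub>L real)) \<Rightarrow> (nat \<Rightarrow> real) \<Rightarrow> ('a \<Rightarrow>\<^sub>L real) \<Rightarrow> bool" where
  "wstar_sums es a y \<longleftrightarrow> (\<forall>x. (\<lambda>n. \<Sum>j<n. a j * blinfun_apply (es j) x) \<longlonglongrightarrow> blinfun_apply y x)"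

definition wstar_schauder_basis :: "(nat \<Rightarrow> 'a::banach) \<Rightarrow> (nat \<Rightarrow> ('a \<Rightarrow>\<^sub>L real)) \<Rightarrow> bool" where
  "wstar_schauder_basis e es \<longleftrightarrow> (\<forall>y. wstar_sums es (\<lambda>j. blinfun_apply y (e j)) y)"

definition uncond_const :: "(nat \<Rightarrow> ('a::banach \<Rightarrow>\<^sub>L real)) \<Rightarrow> real \<Rightarrow> bool" where
  "uncond_const es C \<longleftrightarrow> (\<forall>\<gamma> a y. bounded (range \<gamma>) \<longrightarrow> wstar_sums es a y \<longrightarrow>
      (\<exists>z. wstar_sums es (\<lambda>j. \<gamma> j * a j) z \<and> norm z \<le> C * (SUP j. \<bar>\<gamma> j\<bar>) * norm y))"

definition unconditional :: "(nat \<Rightarrow> ('a::banach \<Rightarrow>\<^sub>L real)) \<Rightarrow> bool" where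
  "unconditional es \<longleftrightarrow> (\<exists>C\<ge>1. uncond_const es C)"

definition K_u :: "(nat \<Rightarrow> ('a::banach \<Rightarrow>\<^sub>L real)) \<Rightarrow> real" where
  "K_u es = Inf {C. C \<ge> 1 \<and> uncond_const es C}"

definition wstar_closure :: "('a::banach \<Rightarrow>\<^sub>L real) set \<Rightarrow> ('a \<Rightarrow>\<^sub>L real) set" where
  "wstar_closure A = {z. \<forall>F \<epsilon>. finite F \<longrightarrow> \<epsilon> > 0 \<longrightarrow>
      (\<exists>w\<in>A. \<forall>x\<in>F. \<bar>blinfun_apply w x - blinfun_apply z x\<bar> < \<epsilon>)}"

(* Sop is the spreading operator S_(n_j): sum_j a_j es_j |-> sum_j a_j es_(n_j)
  (for y in Xdual, its coefficients are a_j = y(e_j)) *)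
definition spread_op :: "(nat \<Rightarrow> 'a::banach) \<Rightarrow> (nat \<Rightarrow> ('a \<Rightarrow>\<^sub>L real)) \<Rightarrow> (nat \<Rightarrow> nat)
    \<Rightarrow> (('a \<Rightarrow>\<^sub>L real) \<Rightarrow>\<^sub>L ('a \<Rightarrow>\<^sub>L real)) \<Rightarrow> bool" where
  "spread_op e es n Sop \<longleftrightarrow> (\<forall>y. wstar_sums (\<lambda>j. es (n j)) (\<lambda>j. blinfun_apply y (e j)) (blinfun_apply Sop y))"

(* set of the numbers ||S|| and ||S^{-1}|| over all increasing sequences *)
definition Ks_set :: "(nat \<Rightarrow> 'a::banach) \<Rightarrow> (nat \<Rightarrow> ('a \<Rightarrow>\<^sub>L real)) \<Rightarrow> real set" where
  "Ks_set e es = {norm Sop | n Sop. strict_mono n \<and> spread_op e es n Sop}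
     \<union> {Sup {norm y / norm (blinfun_apply Sop y) | y. y \<noteq> 0} | n Sop. strict_mono n \<and> spread_op e es n Sop}"

definition K_s :: "(nat \<Rightarrow> 'a::banach) \<Rightarrow> (nat \<Rightarrow> ('a \<Rightarrow>\<^sub>L real)) \<Rightarrow> real" where
  "K_s e es = Sup (Ks_set e es)"

definition subsymmetric :: "(nat \<Rightarrow> 'a::banach) \<Rightarrow> (nat \<Rightarrow> ('a \<Rightarrow>\<^sub>L real)) \<Rightarrow> bool" where
  "subsymmetric e es \<longleftrightarrow> unconditional es \<and>
     (\<forall>n. strict_mono n \<longrightarrow> (\<exists>Sop. spread_op e es n Sop \<and> inj (blinfun_apply Sop) \<and>
         range (blinfun_apply Sop) = wstar_closure (span (range (\<lambda>j. es (n j)))) \<and>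
         (\<exists>c. \<forall>y. norm y \<le> c * norm (blinfun_apply Sop y)))) \<and>
     bdd_above (Ks_set e es)"

definition coord_proj :: "(nat \<Rightarrow> 'a::banach) \<Rightarrow> (nat \<Rightarrow> ('a \<Rightarrow>\<^sub>L real)) \<Rightarrow> nat set
    \<Rightarrow> ('a \<Rightarrow>\<^sub>L real) \<Rightarrow> ('a \<Rightarrow>\<^sub>L real) \<Rightarrow> bool" where
  "coord_proj e es A y z \<longleftrightarrow> wstar_sums es (\<lambda>i. if i \<in> A then blinfun_apply y (e i) else 0) z"

definition condition_C :: "(nat \<Rightarrow> 'a::banach) \<Rightarrow> (nat \<Rightarrow> ('a \<Rightarrow>\<^sub>L real)) \<Rightarrow> bool" where
  "condition_C e es \<longleftrightarrow> (\<forall>\<Lambda> :: nat set. \<forall>\<theta>::real. infinite \<Lambda> \<longrightarrow> \<theta> > 0 \<longrightarrow>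
     (\<exists>A :: nat \<Rightarrow> nat set. (\<forall>j. A j \<subseteq> \<Lambda> \<and> infinite (A j)) \<and>
        (\<forall>i j. i \<noteq> j \<longrightarrow> A i \<inter> A j = {}) \<and>
        (\<forall>x :: nat \<Rightarrow> ('a \<Rightarrow>\<^sub>L real). (\<forall>j. norm (x j) \<le> 1) \<longrightarrow>
           (\<exists>a :: nat \<Rightarrow> real. \<exists>p :: nat \<Rightarrow> ('a \<Rightarrow>\<^sub>L real). \<exists>z.
              summable (\<lambda>j. \<bar>a j\<bar>) \<and> (\<Sum>j. \<bar>a j\<bar>) = 1 \<and>
              (\<forall>j. coord_proj e es (A j) (x j) (p j)) \<and>
              (\<forall>v. (\<lambda>m. \<Sum>j<m. a j * blinfun_apply (p j) v) \<longlonglongrightarrow> blinfun_apply z v) \<and>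
              norm z \<le> \<theta>))))"

end

theory Submission
  imports Defs
begin

text \<open>
  One of \<open>T\<close>, \<open>Id - T\<close> has diagonal entries at least \<open>1/2\<close> on an infinite set; call it \<open>H\<close>. Condition (C)
  makes any bounded functional on the dual small on the vectors supported in some infinite subset
  of a given infinite set, which disposes of the entries of \<open>H\<close> to the right of the diagonal even
  though \<open>H\<close> need not be weak-star continuous. The entries to the left of the diagonal need not
  tend to \<open>0\<close> down a column, but they become almost constant on an infinite set, so they are tested
  against differences \<open>e (n k) - e (m k)\<close>. By (C) there are averages of the \<open>es n\<close> of small norm, so
  these differences can be chosen to keep diagonal entries at least \<open>1/4\<close>. With \<open>M\<close> the spreading
  operator along \<open>n\<close> and \<open>L\<close> the normalised coordinates along the differences, \<open>L H M\<close> is then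
  within \<open>1/2\<close> of the identity.
\<close>

section \<open>Inverting operators close to the identity\<close>

text \<open>Solving \<open>G x = y\<close> is a fixed point problem for a contraction, and the lower
  bound \<open>(1 - c) * norm x \<le> norm (G x)\<close> makes the solution unique and bounded. It
  depends linearly on \<open>y\<close> because \<open>G\<close> is linear and injective.\<close>

lemma blinfun_left_inverse_near_id:
  fixes G :: "'b::banach \<Rightarrow>\<^sub>L 'b"
  assumes c: "c < 1" and near: "\<And>x. norm (blinfun_apply G x - x) \<le> c * norm x"
  obtains V where "V o\<^sub>L G = id_blinfun" "norm V \<le> 1 / (1 - c)"
proof -
  \<comment> \<open>The fixed point theorem asks for a nonnegative factor, while \<open>c\<close>
    may be negative if the space is trivial.\<close>
  let ?c = "max c 0"
  have near': "norm (blinfun_apply G x - x) \<le> ?c * norm x" for x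
    by (rule order_trans[OF near mult_right_mono]) auto
  have "\<exists>x. blinfun_apply G x = y" for y
  proof -
    have "\<exists>!x. y - (blinfun_apply G x - x) = x"
    proof (rule banach_fix_type[where c = ?c])
      show "\<forall>a b. dist (y - (blinfun_apply G a - a)) (y - (blinfun_apply G b - b)) \<le> ?c * dist a b"
      proof (intro allI)
        fix a b
        have "norm (blinfun_apply G (b - a) - (b - a)) \<le> ?c * norm (b - a)" by (rule near')
        then show "dist (y - (blinfun_apply G a - a)) (y - (blinfun_apply G b - b)) \<le> ?c * dist a b"
          by (simp add: dist_norm blinfun.diff_right norm_minus_commute algebra_simps)
      qed
    qed (use c in auto)
    then obtain x where "y - (blinfun_apply G x - x) = x" by blast
    then show ?thesis by (intro exI[of _ x]) (simp add: algebra_simps)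
  qed
  then obtain g where Gg: "\<And>y. blinfun_apply G (g y) = y" by metis
  have lower: "norm x \<le> 1 / (1 - c) * norm (blinfun_apply G x)" for x
  proof -
    have "norm x \<le> norm (blinfun_apply G x) + norm (blinfun_apply G x - x)"
      using norm_triangle_ineq4[of "blinfun_apply G x" "blinfun_apply G x - x"] by simp
    then have "(1 - c) * norm x \<le> norm (blinfun_apply G x)"
      using near[of x] by (simp add: algebra_simps)
    then show ?thesis using c by (simp add: pos_le_divide_eq mult.commute)
  qed
  have inj: "x = y" if "blinfun_apply G x = blinfun_apply G y" for x y
    using lower[of "x - y"] that by (simp add: blinfun.diff_right)
  have gB: "norm (g y) \<le> 1 / (1 - c) * norm y" for y
    using lower[of "g y"] by (simp add: Gg)
  have "bounded_linear g"
  proof (rule bounded_linear_intro)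
    show "norm (g y) \<le> norm y * (1 / (1 - c))" for y using gB[of y] by simp
    show "g (x + y) = g x + g y" for x y
      by (rule inj) (simp add: Gg blinfun.add_right)
    show "g (r *\<^sub>R x) = r *\<^sub>R g x" for r x
      by (rule inj) (simp add: Gg blinfun.scaleR_right)
  qed
  then have g: "blinfun_apply (Blinfun g) = g" by (rule bounded_linear_Blinfun_apply)
  show thesis
  proof (rule that)
    show "Blinfun g o\<^sub>L G = id_blinfun"
      by (rule blinfun_eqI) (simp add: g, rule inj, simp add: Gg)
    show "norm (Blinfun g) \<le> 1 / (1 - c)"
      by (rule norm_blinfun_bound) (use c gB in \<open>simp_all add: g\<close>)
  qed
qed

section \<open>Coordinates, multipliers and spreading operators on the dual\<close>

locale subsymmetric_wstar_basis =
  fixes e :: "nat \<Rightarrow> 'a::banach"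
    and es :: "nat \<Rightarrow> ('a \<Rightarrow>\<^sub>L real)"
  assumes e_norm: "norm (e j) = 1"
    and biorth: "blinfun_apply (es j) (e i) = (if i = j then 1 else 0)"
    and es_norm: "norm (es j) = 1"
    and wstar: "wstar_schauder_basis e es"
    and subsym: "subsymmetric e es"
begin

text \<open>By biorthogonality the partial sums evaluated at \<open>e (n k)\<close> are constant as
  soon as they contain the term with index \<open>k\<close>.\<close>

lemma coord_of_wstar_sums:
  assumes "inj n" "wstar_sums (\<lambda>j. es (n j)) a y"
  shows "blinfun_apply y (e (n k)) = a k"
proof -
  have "(\<lambda>N. \<Sum>j<N. a j * blinfun_apply (es (n j)) (e (n k))) \<longlonglongrightarrow> blinfun_apply y (e (n k))"
    using assms(2) by (simp add: wstar_sums_def)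
  moreover have "eventually (\<lambda>N. (\<Sum>j<N. a j * blinfun_apply (es (n j)) (e (n k))) = a k) sequentially"
    using eventually_gt_at_top[of k]
  proof eventually_elim
    case (elim N)
    have "(\<Sum>j<N. a j * blinfun_apply (es (n j)) (e (n k))) = (\<Sum>j<N. if j = k then a j else 0)"
      by (rule sum.cong) (auto simp: biorth inj_eq[OF assms(1)])
    then show ?case using elim by simp
  qed
  ultimately show ?thesis
    by (intro LIMSEQ_unique[OF _ tendsto_eventually])
qed

lemma coord_of_wstar_sums_outside:
  assumes "i \<notin> range n" "wstar_sums (\<lambda>j. es (n j)) a y"
  shows "blinfun_apply y (e i) = 0"
proof -
  have "(\<lambda>N. \<Sum>j<N. a j * blinfun_apply (es (n j)) (e i)) \<longlonglongrightarrow> blinfun_apply y (e i)"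
    using assms(2) by (simp add: wstar_sums_def)
  moreover have "(\<Sum>j<N. a j * blinfun_apply (es (n j)) (e i)) = 0" for N
    using assms(1) by (auto simp: biorth intro!: sum.neutral)
  ultimately show ?thesis
    by (simp add: LIMSEQ_const_iff)
qed

text \<open>This turns statements about weak-star series into statements about the coordinates
  \<open>y (e i)\<close>; convergence itself is supplied by the basis property.\<close>

lemma wstar_sums_iff: "wstar_sums es a y \<longleftrightarrow> (\<forall>i. blinfun_apply y (e i) = a i)"
proof
  assume "wstar_sums es a y"
  then show "\<forall>i. blinfun_apply y (e i) = a i"
    using coord_of_wstar_sums[of id a y] by simp
next
  assume "\<forall>i. blinfun_apply y (e i) = a i"
  then have "a = (\<lambda>i. blinfun_apply y (e i))" by auto
  then show "wstar_sums es a y"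
    using wstar by (simp add: wstar_schauder_basis_def)
qed

lemma coord_eqI:
  fixes y z :: "'a \<Rightarrow>\<^sub>L real"
  assumes "\<And>i. blinfun_apply y (e i) = blinfun_apply z (e i)"
  shows "y = z"
proof (rule blinfun_eqI)
  fix x
  have "wstar_sums es (\<lambda>i. blinfun_apply y (e i)) y" "wstar_sums es (\<lambda>i. blinfun_apply y (e i)) z"
    using assms by (auto simp: wstar_sums_iff)
  then show "blinfun_apply y x = blinfun_apply z x"
    unfolding wstar_sums_def using LIMSEQ_unique by blast
qed

lemma abs_coord_le: "\<bar>blinfun_apply y (e i)\<bar> \<le> norm y"
  using norm_blinfun[of y "e i"] by (simp add: e_norm)

text \<open>Each \<open>es j\<close> has norm 1, so the partial sums of the weak-star expansion are
  bounded by the sum of the \<open>c j\<close>, and the bound passes to the pointwise limit. Crude,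
  but enough for errors that decay geometrically.\<close>

lemma norm_le_suminf_coords:
  assumes "\<And>i. \<bar>blinfun_apply z (e i)\<bar> \<le> c i" "summable c"
  shows "norm z \<le> suminf c"
proof -
  have c0: "c i \<ge> 0" for i using assms(1)[of i] by linarith
  show ?thesis
  proof (rule norm_blinfun_bound)
    show "0 \<le> suminf c" using c0 assms(2) by (simp add: suminf_nonneg)
    fix x
    have "(\<lambda>n. \<Sum>j<n. blinfun_apply z (e j) * blinfun_apply (es j) x) \<longlonglongrightarrow> blinfun_apply z x"
      using wstar by (simp add: wstar_schauder_basis_def wstar_sums_def)
    then have lim: "(\<lambda>n. norm (\<Sum>j<n. blinfun_apply z (e j) * blinfun_apply (es j) x)) \<longlonglongrightarrow> norm (blinfun_apply z x)"
      by (rule tendsto_norm)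
    have "norm (\<Sum>j<n. blinfun_apply z (e j) * blinfun_apply (es j) x) \<le> suminf c * norm x" for n
    proof -
      have "norm (\<Sum>j<n. blinfun_apply z (e j) * blinfun_apply (es j) x) \<le> (\<Sum>j<n. c j * norm x)"
      proof (rule order_trans[OF norm_sum], rule sum_mono)
        fix j
        have "\<bar>blinfun_apply (es j) x\<bar> \<le> norm x"
          using norm_blinfun[of "es j" x] by (simp add: es_norm)
        then show "norm (blinfun_apply z (e j) * blinfun_apply (es j) x) \<le> c j * norm x"
          using assms(1)[of j] c0[of j] by (simp add: abs_mult mult_mono)
      qed
      also have "\<dots> = (\<Sum>j<n. c j) * norm x" by (simp add: sum_distrib_right)
      also have "\<dots> \<le> suminf c * norm x"
        using sum_le_suminf[OF assms(2)] c0 by (intro mult_right_mono) auto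
      finally show ?thesis .
    qed
    then show "norm (blinfun_apply z x) \<le> suminf c * norm x"
      using lim LIMSEQ_le_const2 by blast
  qed
qed

lemma K_u_ge_1: "K_u es \<ge> 1"
  unfolding K_u_def
  using subsym by (intro cInf_greatest) (auto simp: subsymmetric_def unconditional_def)

text \<open>\<open>K_u\<close> is an infimum, with no admissible constant known to attain it. Since
  coordinates determine \<open>z\<close>, the same vector obeys the bound of every admissible
  constant, hence that of the infimum.\<close>

lemma multiplier:
  fixes y :: "'a \<Rightarrow>\<^sub>L real"
  assumes "\<And>j. \<bar>\<gamma> j\<bar> \<le> B"
  obtains z where "\<And>i. blinfun_apply z (e i) = \<gamma> i * blinfun_apply y (e i)"
    and "norm z \<le> K_u es * B * norm y"
proof -
  let ?S = "{C. C \<ge> 1 \<and> uncond_const es C}"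
  have ne: "?S \<noteq> {}" using subsym by (auto simp: subsymmetric_def unconditional_def)
  have bdd: "bounded (range \<gamma>)" using assms by (auto simp: bounded_iff)
  have y: "wstar_sums es (\<lambda>i. blinfun_apply y (e i)) y" by (simp add: wstar_sums_iff)
  have *: "\<exists>z. (\<forall>i. blinfun_apply z (e i) = \<gamma> i * blinfun_apply y (e i)) \<and> norm z \<le> C * (B * norm y)"
    if C: "C \<in> ?S" for C
  proof -
    obtain z where z: "wstar_sums es (\<lambda>j. \<gamma> j * blinfun_apply y (e j)) z"
      and le: "norm z \<le> C * (SUP j. \<bar>\<gamma> j\<bar>) * norm y"
      using C bdd y unfolding uncond_const_def by blast
    have "(SUP j. \<bar>\<gamma> j\<bar>) \<le> B" by (rule cSUP_least) (use assms in auto)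
    then have "C * (SUP j. \<bar>\<gamma> j\<bar>) * norm y \<le> C * B * norm y"
      using C by (intro mult_right_mono mult_left_mono) auto
    then show ?thesis using z le by (auto simp: wstar_sums_iff mult.assoc)
  qed
  obtain z where z: "\<And>i. blinfun_apply z (e i) = \<gamma> i * blinfun_apply y (e i)"
    using * ne by blast
  have le: "norm z \<le> C * (B * norm y)" if "C \<in> ?S" for C
    using *[OF that] z coord_eqI by metis
  have "norm z \<le> K_u es * (B * norm y)"
  \<comment> \<open>Comparison with the infimum divides by \<open>B * norm y\<close>; if this
    product vanishes, any admissible constant already gives \<open>norm z \<le> 0\<close>.\<close>
  proof (cases "B * norm y \<le> 0")
    case True
    have "B \<ge> 0" using assms[of 0] by linarith
    then have "B * norm y = 0" using True by (metis antisym mult_nonneg_nonneg norm_ge_zero)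
    then show ?thesis using le ne by auto
  next
    case False
    have "norm z / (B * norm y) \<le> K_u es"
      unfolding K_u_def
      by (rule cInf_greatest[OF ne]) (use False le in \<open>auto simp: divide_le_eq\<close>)
    then show ?thesis using False by (simp add: divide_le_eq)
  qed
  then show thesis using that[of z] z by (simp add: mult.assoc)
qed

lemma bdd_above_Ks_set: "bdd_above (Ks_set e es)"
  using subsym by (simp add: subsymmetric_def)

text \<open>The lower bound \<open>c\<close> from subsymmetry may depend on the sequence
  \<open>n\<close>. It makes the set of quotients bounded, so that their supremum, a member of
  \<open>Ks_set\<close>, dominates each of them and \<open>c\<close> can be replaced by
  \<open>K_s\<close>.\<close>

lemma spread:
  assumes n: "strict_mono n"
  shows "\<exists>S. (\<forall>y k. blinfun_apply (blinfun_apply S y) (e (n k)) = blinfun_apply y (e k)) \<and>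
    (\<forall>y i. i \<notin> range n \<longrightarrow> blinfun_apply (blinfun_apply S y) (e i) = 0) \<and>
    norm S \<le> K_s e es \<and>
    (\<forall>y. norm y \<le> K_s e es * norm (blinfun_apply S y)) \<and>
    range (blinfun_apply S) = wstar_closure (span (range (\<lambda>j. es (n j))))"
proof -
  obtain S c where S: "spread_op e es n S" and inj: "inj (blinfun_apply S)"
    and ran: "range (blinfun_apply S) = wstar_closure (span (range (\<lambda>j. es (n j))))"
    and c: "\<And>y. norm y \<le> c * norm (blinfun_apply S y)"
    using subsym n unfolding subsymmetric_def by blast
  have S': "wstar_sums (\<lambda>j. es (n j)) (\<lambda>j. blinfun_apply y (e j)) (blinfun_apply S y)" for y
    using S by (simp add: spread_op_def)
  have 1: "norm S \<in> Ks_set e es"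
    using S n unfolding Ks_set_def by blast
  have 2: "Sup {norm y / norm (blinfun_apply S y) | y. y \<noteq> 0} \<in> Ks_set e es" (is "Sup ?Q \<in> _")
    using S n unfolding Ks_set_def by blast
  have "norm y \<le> K_s e es * norm (blinfun_apply S y)" for y
  proof (cases "y = 0")
    case False
    have pos: "norm (blinfun_apply S y) > 0"
      using inj False by (metis blinfun.zero_right injD zero_less_norm_iff)
    have "norm y / norm (blinfun_apply S y) \<le> Sup ?Q"
    proof (rule cSup_upper)
      show "bdd_above ?Q"
      proof (rule bdd_aboveI[of _ c])
        fix q assume "q \<in> ?Q"
        then obtain u where u: "u \<noteq> 0" "q = norm u / norm (blinfun_apply S u)" by blast
        have "norm (blinfun_apply S u) > 0"
          using inj u by (metis blinfun.zero_right injD zero_less_norm_iff)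
        then show "q \<le> c" using c[of u] u by (simp add: divide_le_eq)
      qed
    qed (use False in blast)
    also have "\<dots> \<le> K_s e es"
      unfolding K_s_def by (rule cSup_upper[OF 2 bdd_above_Ks_set])
    finally show ?thesis using pos by (simp add: divide_le_eq)
  qed simp
  moreover have "norm S \<le> K_s e es"
    unfolding K_s_def by (rule cSup_upper[OF 1 bdd_above_Ks_set])
  ultimately show ?thesis
    using ran coord_of_wstar_sums[OF strict_mono_imp_inj_on[OF n] S']
      coord_of_wstar_sums_outside[OF _ S'] by blast
qed

lemma K_s_ge_1: "K_s e es \<ge> 1"
proof -
  obtain S where "\<And>(y :: 'a \<Rightarrow>\<^sub>L real) k. blinfun_apply (blinfun_apply S y) (e (id k)) = blinfun_apply y (e k)"
    and S: "norm S \<le> K_s e es"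
    using spread[OF strict_mono_id] by blast
  then have "blinfun_apply S (es 0) = es 0" by (intro coord_eqI) simp
  then have "norm S \<ge> 1" using norm_blinfun[of S "es 0"] by (simp add: es_norm)
  then show ?thesis using S by linarith
qed

text \<open>The restriction \<open>p\<close> of \<open>y\<close> to the coordinates in
  \<open>range n\<close> lies in the weak-star closed span that is the range of the spreading
  operator \<open>S\<close>, so \<open>p\<close> is some \<open>S u\<close>. Restricting costs a
  factor \<open>K_u\<close>, inverting \<open>S\<close> a factor \<open>K_s\<close>.\<close>

lemma compress:
  fixes y :: "'a \<Rightarrow>\<^sub>L real"
  assumes n: "strict_mono n"
  obtains u where "\<And>k. blinfun_apply u (e k) = blinfun_apply y (e (n k))"
    and "norm u \<le> K_u es * K_s e es * norm y"
proof -
  obtain S where S: "\<And>y k. blinfun_apply (blinfun_apply S y) (e (n k)) = blinfun_apply y (e k)"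
    and lower: "\<And>y. norm y \<le> K_s e es * norm (blinfun_apply S y)"
    and ran: "range (blinfun_apply S) = wstar_closure (span (range (\<lambda>j. es (n j))))"
    using spread[OF n] by blast
  define \<gamma> :: "nat \<Rightarrow> real" where "\<gamma> i = (if i \<in> range n then 1 else 0)" for i
  obtain p where p: "\<And>i. blinfun_apply p (e i) = \<gamma> i * blinfun_apply y (e i)"
    and np: "norm p \<le> K_u es * 1 * norm y"
    by (rule multiplier[of \<gamma> 1 y]) (auto simp: \<gamma>_def)
  \<comment> \<open>These partial sums lie in the span and converge weak-star to \<open>p\<close>; a
    common large \<open>N\<close> serves any finite set of test points.\<close>
  let ?s = "\<lambda>N. \<Sum>i<N. blinfun_apply p (e i) *\<^sub>R es i"
  have s: "?s N \<in> span (range (\<lambda>j. es (n j)))" for N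
  proof (rule span_sum)
    fix i
    show "blinfun_apply p (e i) *\<^sub>R es i \<in> span (range (\<lambda>j. es (n j)))"
    proof (cases "i \<in> range n")
      case True
      then have "es i \<in> range (\<lambda>j. es (n j))" by auto
      then show ?thesis by (intro span_scale span_base)
    qed (simp add: p \<gamma>_def span_zero)
  qed
  have "p \<in> wstar_closure (span (range (\<lambda>j. es (n j))))"
    unfolding wstar_closure_def
  proof (intro CollectI allI impI)
    fix F :: "'a set" and \<epsilon> :: real assume F: "finite F" "\<epsilon> > 0"
    have "\<forall>\<^sub>F N in sequentially. \<bar>blinfun_apply (?s N) x - blinfun_apply p x\<bar> < \<epsilon>" for x
    proof -
      have "(\<lambda>N. blinfun_apply (?s N) x) \<longlonglongrightarrow> blinfun_apply p x"
        using wstar by (simp add: wstar_schauder_basis_def wstar_sums_def blinfun.bilinear_simps)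
      then show ?thesis using F(2) by (auto dest!: tendstoD simp: dist_real_def)
    qed
    then have "\<forall>\<^sub>F N in sequentially. \<forall>x\<in>F. \<bar>blinfun_apply (?s N) x - blinfun_apply p x\<bar> < \<epsilon>"
      using F(1) by (simp add: eventually_ball_finite_distrib)
    then obtain N where "\<forall>x\<in>F. \<bar>blinfun_apply (?s N) x - blinfun_apply p x\<bar> < \<epsilon>"
      by (auto simp: eventually_sequentially)
    then show "\<exists>w\<in>span (range (\<lambda>j. es (n j))). \<forall>x\<in>F. \<bar>blinfun_apply w x - blinfun_apply p x\<bar> < \<epsilon>"
      using s by blast
  qed
  then obtain u where u: "p = blinfun_apply S u" using ran by blast
  have "norm u \<le> K_s e es * norm p" using lower u by blast
  also have "\<dots> \<le> K_s e es * (K_u es * norm y)"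
    using np K_s_ge_1 by (intro mult_left_mono) auto
  finally have "norm u \<le> K_u es * K_s e es * norm y" by (simp add: mult_ac)
  moreover have "blinfun_apply u (e k) = blinfun_apply y (e (n k))" for k
    using S[of u k] u p[of "n k"] by (simp add: \<gamma>_def)
  ultimately show thesis using that by blast
qed

text \<open>Coordinates determine a vector, so a choice of \<open>z\<close> for every
  \<open>y\<close> is automatically linear when all its coordinates are linear in \<open>y\<close>.
  This allows operators to be defined coordinatewise.\<close>

lemma blinfun_of_coords:
  fixes f :: "nat \<Rightarrow> ('a \<Rightarrow>\<^sub>L real) \<Rightarrow> real"
  assumes lin: "\<And>k. linear (f k)"
    and ex: "\<And>y. \<exists>z. (\<forall>k. blinfun_apply z (e k) = f k y) \<and> norm z \<le> B * norm y"
    and B: "B \<ge> 0"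
  obtains L where "\<And>y k. blinfun_apply (blinfun_apply L y) (e k) = f k y" and "norm L \<le> B"
proof -
  obtain g where g: "\<And>y k. blinfun_apply (g y) (e k) = f k y" and gB: "\<And>y. norm (g y) \<le> B * norm y"
    using ex by metis
  have "bounded_linear g"
  proof (rule bounded_linear_intro)
    show "g (x + y) = g x + g y" for x y
      by (rule coord_eqI) (simp add: g blinfun.bilinear_simps linear_add[OF lin])
    show "g (r *\<^sub>R x) = r *\<^sub>R g x" for r x
      by (rule coord_eqI) (simp add: g blinfun.bilinear_simps linear_scale[OF lin])
    show "norm (g x) \<le> norm x * B" for x using gB[of x] by (simp add: mult.commute)
  qed
  then have "blinfun_apply (Blinfun g) = g" by (rule bounded_linear_Blinfun_apply)
  then show thesis
    using that[of "Blinfun g"] g norm_blinfun_bound[OF B, of "Blinfun g"] gB by simp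
qed

section \<open>Consequences of condition (C)\<close>

text \<open>Unconditionality lets the coefficients in condition (C) be multiplied by arbitrary signs.\<close>

lemma condition_C_signs:
  assumes condC: "condition_C e es" and "infinite \<Lambda>" "\<theta> > 0"
  shows "\<exists>A :: nat \<Rightarrow> nat set. (\<forall>j. A j \<subseteq> \<Lambda>) \<and> (\<forall>j. infinite (A j)) \<and>
    (\<forall>u :: nat \<Rightarrow> ('a \<Rightarrow>\<^sub>L real). (\<forall>j. norm (u j) \<le> 1) \<longrightarrow> (\<forall>j i. i \<notin> A j \<longrightarrow> blinfun_apply (u j) (e i) = 0) \<longrightarrow>
      (\<exists>a. summable (\<lambda>j. \<bar>a j\<bar>) \<and> (\<Sum>j. \<bar>a j\<bar>) = 1 \<and>
        (\<forall>\<epsilon>. (\<forall>j. \<bar>\<epsilon> j\<bar> \<le> 1) \<longrightarrow>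
          (\<exists>s. (\<lambda>j. (\<epsilon> j * a j) *\<^sub>R u j) sums s \<and> norm s \<le> \<theta>))))"
proof -
  \<comment> \<open>Changing signs may enlarge the norm by a factor \<open>K_u\<close>, so condition
    (C) is applied with a smaller threshold.\<close>
  define \<theta>' where "\<theta>' = \<theta> / K_u es"
  have \<theta>': "\<theta>' > 0" using K_u_ge_1 assms(3) by (simp add: \<theta>'_def)
  obtain A :: "nat \<Rightarrow> nat set" where A: "\<forall>j. A j \<subseteq> \<Lambda> \<and> infinite (A j)"
    and disj: "\<forall>i j. i \<noteq> j \<longrightarrow> A i \<inter> A j = {}"
    and AC: "\<forall>x :: nat \<Rightarrow> ('a \<Rightarrow>\<^sub>L real). (\<forall>j. norm (x j) \<le> 1) \<longrightarrow>
           (\<exists>a :: nat \<Rightarrow> real. \<exists>p :: nat \<Rightarrow> ('a \<Rightarrow>\<^sub>L real). \<exists>z.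
              summable (\<lambda>j. \<bar>a j\<bar>) \<and> (\<Sum>j. \<bar>a j\<bar>) = 1 \<and>
              (\<forall>j. coord_proj e es (A j) (x j) (p j)) \<and>
              (\<forall>v. (\<lambda>m. \<Sum>j<m. a j * blinfun_apply (p j) v) \<longlonglongrightarrow> blinfun_apply z v) \<and>
              norm z \<le> \<theta>')"
    using condC[unfolded condition_C_def, THEN spec, THEN spec, THEN mp, OF assms(2), THEN mp, OF \<theta>']
    by (elim exE conjE) (rule that)
  show ?thesis
  proof (intro exI[of _ A] conjI allI[where P = "\<lambda>u. _ u \<longrightarrow> _ u"] impI)
    show "\<forall>j. A j \<subseteq> \<Lambda>" "\<forall>j. infinite (A j)" using A by auto
    fix u :: "nat \<Rightarrow> ('a \<Rightarrow>\<^sub>L real)"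
    assume u1: "\<forall>j. norm (u j) \<le> 1"
      and "\<forall>j i. i \<notin> A j \<longrightarrow> blinfun_apply (u j) (e i) = 0"
    then have supp: "\<And>j i. i \<notin> A j \<Longrightarrow> blinfun_apply (u j) (e i) = 0" by blast
    obtain a p z where a: "summable (\<lambda>j. \<bar>a j\<bar>)" "(\<Sum>j. \<bar>a j\<bar>) = 1"
      and p: "\<And>j. coord_proj e es (A j) (u j) (p j)"
      and z: "\<And>v. (\<lambda>j. a j * blinfun_apply (p j) v) sums blinfun_apply z v" and nz: "norm z \<le> \<theta>'"
      using AC[THEN spec, THEN mp, OF u1] unfolding sums_def by blast
    have pu: "p j = u j" for j
      using p[of j] supp[of _ j] by (intro coord_eqI) (auto simp: coord_proj_def wstar_sums_iff)
    have "\<exists>s. (\<lambda>j. (\<epsilon> j * a j) *\<^sub>R u j) sums s \<and> norm s \<le> \<theta>" if \<epsilon>: "\<And>j. \<bar>\<epsilon> j\<bar> \<le> 1" for \<epsilon>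
    proof -
      \<comment> \<open>The blocks are disjoint, so the multiplier can take the value
        \<open>\<epsilon> j\<close> on all of \<open>A j\<close>; 0 is a default off the blocks,
        where every \<open>u j\<close> vanishes.\<close>
      define \<gamma> where "\<gamma> i = (if \<exists>j. i \<in> A j then \<epsilon> (SOME j. i \<in> A j) else 0)" for i
      have \<gamma>: "\<gamma> i = \<epsilon> j" if "i \<in> A j" for i j
      proof -
        have "i \<in> A (SOME j. i \<in> A j)" by (rule someI) (rule that)
        then have "(SOME j. i \<in> A j) = j" using disj that by blast
        then show ?thesis using that by (auto simp: \<gamma>_def)
      qed
      have "\<bar>\<gamma> i\<bar> \<le> 1" for i using \<epsilon> by (simp add: \<gamma>_def)
      then obtain z' where z': "\<And>i. blinfun_apply z' (e i) = \<gamma> i * blinfun_apply z (e i)"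
        and nz': "norm z' \<le> K_u es * 1 * norm z"
        by (rule multiplier[of \<gamma> 1 z]) (rule that)
      have "norm ((\<epsilon> j * a j) *\<^sub>R u j) \<le> \<bar>a j\<bar>" for j
        using mult_mono[OF mult_right_mono[OF \<epsilon>[of j] abs_ge_zero[of "a j"]] u1[THEN spec, of j]]
        by (simp add: abs_mult)
      then have "summable (\<lambda>j. (\<epsilon> j * a j) *\<^sub>R u j)"
        by (intro summable_comparison_test[OF _ a(1)]) blast
      then obtain s where s: "(\<lambda>j. (\<epsilon> j * a j) *\<^sub>R u j) sums s"
        by (auto simp: summable_def)
      \<comment> \<open>Condition (C) provides only a weak-star limit \<open>z\<close>, whereas
        absolute summability gives a norm limit \<open>s\<close>. They are compared by coordinates,
        each of which meets at most one block.\<close>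
      have "s = z'"
      proof (rule coord_eqI)
        fix i
        have "(\<lambda>j. \<gamma> i * (a j * blinfun_apply (u j) (e i))) sums (\<gamma> i * blinfun_apply z (e i))"
          using z[of "e i"] by (intro sums_mult) (simp add: pu)
        moreover have "\<gamma> i * (a j * blinfun_apply (u j) (e i)) = \<epsilon> j * a j * blinfun_apply (u j) (e i)" for j
          using \<gamma>[of i j] supp[of i j] by (cases "i \<in> A j") auto
        moreover have "(\<lambda>j. blinfun_apply ((\<epsilon> j * a j) *\<^sub>R u j) (e i)) sums blinfun_apply s (e i)"
          using s by (rule bounded_linear.sums[OF blinfun.bounded_linear_left])
        ultimately show "blinfun_apply s (e i) = blinfun_apply z' (e i)"
          by (simp add: z' blinfun.bilinear_simps sums_iff)
      qed
      moreover have "norm z' \<le> \<theta>"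
      proof -
        have "K_u es * norm z \<le> K_u es * \<theta>'" using nz K_u_ge_1 by (intro mult_left_mono) auto
        also have "\<dots> = \<theta>" using K_u_ge_1 by (simp add: \<theta>'_def)
        finally show ?thesis using nz' by simp
      qed
      ultimately show ?thesis using s by blast
    qed
    then show "\<exists>a. summable (\<lambda>j. \<bar>a j\<bar>) \<and> (\<Sum>j. \<bar>a j\<bar>) = 1 \<and>
        (\<forall>\<epsilon>. (\<forall>j. \<bar>\<epsilon> j\<bar> \<le> 1) \<longrightarrow>
          (\<exists>s. (\<lambda>j. (\<epsilon> j * a j) *\<^sub>R u j) sums s \<and> norm s \<le> \<theta>))"
      using a by blast
  qed
qed

text \<open>If no block \<open>A j\<close> worked, each would carry a unit vector \<open>u j\<close>
  with \<open>\<bar>\<phi> (u j)\<bar> > \<eta>\<close>. A signed combination of these would have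
  norm at most \<open>\<eta> / (2 * B)\<close> but value at least \<open>\<eta>\<close>. The series
  converges in norm, so \<open>\<phi>\<close> may be applied term by term without weak-star
  continuity.\<close>

lemma functional_small_on_subset:
  fixes \<phi> :: "('a \<Rightarrow>\<^sub>L real) \<Rightarrow> real"
  assumes condC: "condition_C e es" and \<Lambda>: "infinite \<Lambda>" and \<eta>: "\<eta> > 0" and \<phi>: "bounded_linear \<phi>"
  obtains \<Lambda>' where "\<Lambda>' \<subseteq> \<Lambda>" "infinite \<Lambda>'"
    and "\<And>w. (\<And>i. i \<notin> \<Lambda>' \<Longrightarrow> blinfun_apply w (e i) = 0) \<Longrightarrow> \<bar>\<phi> w\<bar> \<le> \<eta> * norm w"
proof (rule ccontr)
  assume neg: "\<not> thesis"
  obtain B where B: "B > 0" "\<And>x. norm (\<phi> x) \<le> norm x * B"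
    using bounded_linear.pos_bounded[OF \<phi>] by blast
  have \<theta>: "\<eta> / (2 * B) > 0" using B(1) \<eta> by simp
  obtain A :: "nat \<Rightarrow> nat set" where A: "\<forall>j. A j \<subseteq> \<Lambda>" "\<forall>j. infinite (A j)"
    and AC: "\<forall>u :: nat \<Rightarrow> ('a \<Rightarrow>\<^sub>L real). (\<forall>j. norm (u j) \<le> 1) \<longrightarrow> (\<forall>j i. i \<notin> A j \<longrightarrow> blinfun_apply (u j) (e i) = 0) \<longrightarrow>
      (\<exists>a. summable (\<lambda>j. \<bar>a j\<bar>) \<and> (\<Sum>j. \<bar>a j\<bar>) = 1 \<and>
        (\<forall>\<epsilon>. (\<forall>j. \<bar>\<epsilon> j\<bar> \<le> 1) \<longrightarrow>
          (\<exists>s. (\<lambda>j. (\<epsilon> j * a j) *\<^sub>R u j) sums s \<and> norm s \<le> \<eta> / (2 * B))))"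
    using condition_C_signs[OF condC \<Lambda> \<theta>] by (elim exE conjE) (rule that)
  have "\<exists>w. (\<forall>i. i \<notin> A j \<longrightarrow> blinfun_apply w (e i) = 0) \<and> \<bar>\<phi> w\<bar> > \<eta> * norm w" for j
    using neg that[OF A(1)[THEN spec] A(2)[THEN spec], of j] by (meson not_le)
  then obtain w where supp: "\<And>j i. i \<notin> A j \<Longrightarrow> blinfun_apply (w j) (e i) = 0"
    and big: "\<And>j. \<bar>\<phi> (w j)\<bar> > \<eta> * norm (w j)"
    by metis
  define u where "u j = w j /\<^sub>R norm (w j)" for j
  have w0: "w j \<noteq> 0" for j
    using big[of j] linear_0[OF bounded_linear.linear[OF \<phi>]] by auto
  have u1: "norm (u j) = 1" for j using w0 by (simp add: u_def)
  have ubig: "\<bar>\<phi> (u j)\<bar> > \<eta>" for j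
    using big[of j] w0[of j] by (simp add: u_def linear_scale[OF bounded_linear.linear[OF \<phi>]] abs_mult field_simps)
  have "\<forall>j i. i \<notin> A j \<longrightarrow> blinfun_apply (u j) (e i) = 0"
    using supp by (simp add: u_def blinfun.bilinear_simps)
  then obtain a where a: "summable (\<lambda>j. \<bar>a j\<bar>)" "(\<Sum>j. \<bar>a j\<bar>) = 1"
    and s: "\<And>\<epsilon>. (\<forall>j. \<bar>\<epsilon> j\<bar> \<le> 1) \<Longrightarrow> (\<exists>s. (\<lambda>j. (\<epsilon> j * a j) *\<^sub>R u j) sums s \<and> norm s \<le> \<eta> / (2 * B))"
    using AC[THEN spec, of u] u1 by auto
  \<comment> \<open>These signs turn the terms of \<open>\<phi> s\<close> into
    \<open>\<bar>a j\<bar> * \<bar>\<phi> (u j)\<bar>\<close>, so nothing cancels.\<close>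
  obtain s where s: "(\<lambda>j. (sgn (a j * \<phi> (u j)) * a j) *\<^sub>R u j) sums s" and ns: "norm s \<le> \<eta> / (2 * B)"
    using s[of "\<lambda>j. sgn (a j * \<phi> (u j))"] by (auto simp: abs_sgn_eq)
  have "(\<lambda>j. \<phi> ((sgn (a j * \<phi> (u j)) * a j) *\<^sub>R u j)) sums \<phi> s"
    using s by (rule bounded_linear.sums[OF \<phi>])
  moreover have "\<phi> ((sgn (a j * \<phi> (u j)) * a j) *\<^sub>R u j) = \<bar>a j\<bar> * \<bar>\<phi> (u j)\<bar>" for j
  proof -
    have "\<phi> ((sgn (a j * \<phi> (u j)) * a j) *\<^sub>R u j) = sgn (a j * \<phi> (u j)) * (a j * \<phi> (u j))"
      by (simp add: linear_scale[OF bounded_linear.linear[OF \<phi>]])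
    then show ?thesis by (simp only: sgn_mult_self_eq[symmetric] mult.commute abs_sgn[symmetric] abs_mult)
  qed
  ultimately have "(\<lambda>j. \<bar>a j\<bar> * \<bar>\<phi> (u j)\<bar>) sums \<phi> s" by simp
  moreover have "(\<lambda>j. \<bar>a j\<bar> * \<eta>) sums (1 * \<eta>)"
    using a by (intro sums_mult2) (simp add: sums_iff)
  moreover have "\<bar>a j\<bar> * \<eta> \<le> \<bar>a j\<bar> * \<bar>\<phi> (u j)\<bar>" for j
    using less_imp_le[OF ubig] by (rule mult_left_mono) simp
  ultimately have "1 * \<eta> \<le> \<phi> s"
    by (meson sums_le)
  moreover have "\<phi> s \<le> \<eta> / (2 * B) * B"
    using B(2)[of s] mult_right_mono[OF ns less_imp_le[OF B(1)]] by simp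
  ultimately show False using B(1) \<eta> by simp
qed

text \<open>Otherwise every \<open>H (es n)\<close> with \<open>n\<close> in
  \<open>\<Lambda>\<close> has entries above \<open>\<delta>\<close> at all later indices of
  \<open>\<Lambda>\<close>. Condition (C) yields a positive combination of finitely many such
  \<open>es n\<close> with small norm, yet its image has a large coordinate at one index beyond them
  all.\<close>

lemma small_entry:
  fixes H :: "('a \<Rightarrow>\<^sub>L real) \<Rightarrow>\<^sub>L ('a \<Rightarrow>\<^sub>L real)"
  assumes condC: "condition_C e es" and \<Lambda>: "infinite \<Lambda>" and \<delta>: "\<delta> > 0"
  shows "\<exists>n\<in>\<Lambda>. \<exists>m\<in>\<Lambda>. n < m \<and> blinfun_apply (blinfun_apply H (es n)) (e m) \<le> \<delta>"
proof (rule ccontr)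
  assume neg: "\<not> ?thesis"
  define \<theta> where "\<theta> = \<delta> / (2 * (norm H + 1))"
  have H1: "norm H + 1 > 0" using norm_ge_zero[of H] by linarith
  have \<theta>: "\<theta> > 0" using H1 \<delta> by (simp add: \<theta>_def)
  obtain A :: "nat \<Rightarrow> nat set" where A: "\<forall>j. A j \<subseteq> \<Lambda>" "\<forall>j. infinite (A j)"
    and AC: "\<forall>u :: nat \<Rightarrow> ('a \<Rightarrow>\<^sub>L real). (\<forall>j. norm (u j) \<le> 1) \<longrightarrow> (\<forall>j i. i \<notin> A j \<longrightarrow> blinfun_apply (u j) (e i) = 0) \<longrightarrow>
      (\<exists>a. summable (\<lambda>j. \<bar>a j\<bar>) \<and> (\<Sum>j. \<bar>a j\<bar>) = 1 \<and>
        (\<forall>\<epsilon>. (\<forall>j. \<bar>\<epsilon> j\<bar> \<le> 1) \<longrightarrow>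
          (\<exists>s. (\<lambda>j. (\<epsilon> j * a j) *\<^sub>R u j) sums s \<and> norm s \<le> \<theta>)))"
    using condition_C_signs[OF condC \<Lambda> \<theta>] by (elim exE conjE) (rule that)
  have "\<exists>i. i \<in> A j" for j using A(2) by (metis all_not_in_conv finite.emptyI)
  then obtain i where i: "\<And>j. i j \<in> A j" by metis
  have "\<exists>a. summable (\<lambda>j. \<bar>a j\<bar>) \<and> (\<Sum>j. \<bar>a j\<bar>) = 1 \<and>
        (\<forall>\<epsilon>. (\<forall>j. \<bar>\<epsilon> j\<bar> \<le> 1) \<longrightarrow>
          (\<exists>s. (\<lambda>j. (\<epsilon> j * a j) *\<^sub>R es (i j)) sums s \<and> norm s \<le> \<theta>))"
    by (rule AC[THEN spec, THEN mp, THEN mp]) (use i in \<open>auto simp: es_norm biorth\<close>)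
  then obtain a :: "nat \<Rightarrow> real" where a: "summable (\<lambda>j. \<bar>a j\<bar>)" "(\<Sum>j. \<bar>a j\<bar>) = 1"
    and s: "\<And>\<epsilon>. (\<forall>j. \<bar>\<epsilon> j\<bar> \<le> 1) \<Longrightarrow> (\<exists>s. (\<lambda>j. (\<epsilon> j * a j) *\<^sub>R es (i j)) sums s \<and> norm s \<le> \<theta>)"
    by blast
  have "(\<lambda>J. \<Sum>j<J. \<bar>a j\<bar>) \<longlonglongrightarrow> 1"
    using summable_LIMSEQ[OF a(1)] a(2) by simp
  then have "\<forall>\<^sub>F J in sequentially. (\<Sum>j<J. \<bar>a j\<bar>) > 1/2"
    by (rule order_tendstoD) simp
  \<comment> \<open>Cutting at \<open>J\<close> keeps more than half of the weight and leaves
    finitely many indices \<open>i j\<close>, so that a single \<open>m\<close> can lie beyond all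
    of them.\<close>
  then obtain J where J: "(\<Sum>j<J. \<bar>a j\<bar>) > 1/2" by (auto simp: eventually_sequentially)
  \<comment> \<open>The cut is itself a choice of multipliers of modulus at most 1: the signs of
    \<open>a j\<close> below \<open>J\<close>, then 0.\<close>
  obtain s where s: "(\<lambda>j. ((if j < J then sgn (a j) else 0) * a j) *\<^sub>R es (i j)) sums s" and ns: "norm s \<le> \<theta>"
    using s[of "\<lambda>j. if j < J then sgn (a j) else 0", OF allI] by (fastforce simp: abs_sgn_eq)
  have "(\<lambda>j. ((if j < J then sgn (a j) else 0) * a j) *\<^sub>R es (i j)) sums
      (\<Sum>j<J. ((if j < J then sgn (a j) else 0) * a j) *\<^sub>R es (i j))"
    by (rule sums_finite) auto
  then have "s = (\<Sum>j<J. ((if j < J then sgn (a j) else 0) * a j) *\<^sub>R es (i j))"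
    by (rule sums_unique2[OF s])
  also have "\<dots> = (\<Sum>j<J. \<bar>a j\<bar> *\<^sub>R es (i j))"
    by (intro sum.cong) (auto simp: abs_sgn mult.commute)
  finally have s_eq: "s = (\<Sum>j<J. \<bar>a j\<bar> *\<^sub>R es (i j))" .
  obtain b where b: "\<And>j. j < J \<Longrightarrow> i j \<le> b"
    using finite_nat_set_iff_bounded_le[of "i ` {..<J}"] by auto
  obtain m where m: "m \<in> \<Lambda>" "b < m"
    using \<Lambda> unfolding infinite_nat_iff_unbounded by blast
  have gt: "blinfun_apply (blinfun_apply H (es (i j))) (e m) \<ge> \<delta>" if "j < J" for j
  proof (rule ccontr)
    assume "\<not> ?thesis"
    moreover have "i j \<in> \<Lambda>" "i j < m" using i A(1) m(2) b[OF that] by auto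
    ultimately show False using neg m(1) by (meson less_imp_le not_le)
  qed
  have "(\<Sum>j<J. \<bar>a j\<bar>) * \<delta> \<le> (\<Sum>j<J. \<bar>a j\<bar> * blinfun_apply (blinfun_apply H (es (i j))) (e m))"
    unfolding sum_distrib_right using gt by (intro sum_mono mult_left_mono) auto
  also have "\<dots> = blinfun_apply (blinfun_apply H s) (e m)"
    by (simp add: s_eq blinfun.bilinear_simps)
  also have "\<dots> \<le> norm (blinfun_apply H s)" using abs_coord_le abs_le_D1 by blast
  also have "\<dots> \<le> (norm H + 1) * \<theta>"
    by (rule order_trans[OF norm_blinfun]) (use ns in \<open>auto intro!: mult_mono\<close>)
  also have "\<dots> = \<delta> / 2" using H1 unfolding \<theta>_def by (simp add: divide_simps)
  finally show False using mult_strict_right_mono[OF J \<delta>] by simp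
qed

section \<open>Construction of the test vectors\<close>

text \<open>Pigeonhole: the coordinates of one \<open>y\<close> are bounded, so infinitely many of
  them fall into the same interval of length \<open>\<delta>\<close>. Finitely many \<open>y\<close>
  are treated by successive thinning.\<close>

lemma almost_constant_on_subset:
  fixes Y :: "('a \<Rightarrow>\<^sub>L real) set"
  assumes "finite Y" "infinite \<Lambda>" and \<delta>: "\<delta> > 0"
  shows "\<exists>\<Lambda>'\<subseteq>\<Lambda>. infinite \<Lambda>' \<and>
    (\<forall>y\<in>Y. \<forall>n\<in>\<Lambda>'. \<forall>m\<in>\<Lambda>'. \<bar>blinfun_apply y (e n) - blinfun_apply y (e m)\<bar> \<le> \<delta>)"
  using assms(1,2)
proof (induction Y rule: finite_induct)
  case empty
  then show ?case by blast
next
  case (insert y Y)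
  then obtain \<Lambda>1 where \<Lambda>1: "\<Lambda>1 \<subseteq> \<Lambda>" "infinite \<Lambda>1"
    "\<forall>y\<in>Y. \<forall>n\<in>\<Lambda>1. \<forall>m\<in>\<Lambda>1. \<bar>blinfun_apply y (e n) - blinfun_apply y (e m)\<bar> \<le> \<delta>"
    by blast
  let ?f = "\<lambda>n. \<lfloor>blinfun_apply y (e n) / \<delta>\<rfloor>"
  have "?f n \<in> {\<lfloor>- norm y / \<delta>\<rfloor>..\<lfloor>norm y / \<delta>\<rfloor>}" for n
    using abs_coord_le[of y n] \<delta> by (simp only: atLeastAtMost_iff)
      (intro conjI floor_mono divide_right_mono; linarith)
  then have "finite (?f ` \<Lambda>1)"
    by (intro finite_subset[OF _ finite_atLeastAtMost_int]) blast
  then obtain n0 where n0: "infinite {n \<in> \<Lambda>1. ?f n = ?f n0}"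
    using pigeonhole_infinite[OF \<Lambda>1(2)] by blast
  have "\<bar>blinfun_apply y (e n) - blinfun_apply y (e m)\<bar> \<le> \<delta>" if "?f n = ?f m" for n m
  proof -
    have "\<bar>blinfun_apply y (e n) / \<delta> - blinfun_apply y (e m) / \<delta>\<bar> \<le> 1"
      using that by linarith
    then show ?thesis
      using \<delta> by (simp flip: diff_divide_distrib add: divide_le_eq)
  qed
  then show ?case
    using \<Lambda>1 n0 by (intro exI[of _ "{n \<in> \<Lambda>1. ?f n = ?f n0}"]) auto
qed

text \<open>One step of the construction. A first thinning makes the members of \<open>Y\<close>
  almost constant, hence small on differences \<open>e n - e m\<close>. A pair with a small entry
  \<open>H (es n) (e m)\<close> keeps the diagonal value at least \<open>1/2 - 1/4\<close>. A second
  thinning, beyond \<open>m\<close>, controls all vectors still to be chosen.\<close>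

lemma next_test_vector:
  fixes H :: "('a \<Rightarrow>\<^sub>L real) \<Rightarrow>\<^sub>L ('a \<Rightarrow>\<^sub>L real)"
  assumes condC: "condition_C e es" and \<Lambda>: "infinite \<Lambda>" and \<delta>: "\<delta> > 0" and Y: "finite Y"
    and diag: "\<forall>i\<in>\<Lambda>. blinfun_apply (blinfun_apply H (es i)) (e i) \<ge> 1 / 2"
  shows "\<exists>n m \<Lambda>'. n \<in> \<Lambda> \<and> m \<in> \<Lambda> \<and> n < m \<and> \<Lambda>' \<subseteq> \<Lambda> \<and> infinite \<Lambda>' \<and> (\<forall>i\<in>\<Lambda>'. m < i) \<and>
    blinfun_apply (blinfun_apply H (es n)) (e n - e m) \<ge> 1 / 4 \<and>
    (\<forall>y\<in>Y. \<bar>blinfun_apply y (e n - e m)\<bar> \<le> \<delta>) \<and>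
    (\<forall>w. (\<forall>i. i \<notin> \<Lambda>' \<longrightarrow> blinfun_apply w (e i) = 0) \<longrightarrow>
      \<bar>blinfun_apply (blinfun_apply H w) (e n - e m)\<bar> \<le> \<delta> * norm w)"
proof -
  obtain \<Lambda>1 where \<Lambda>1: "\<Lambda>1 \<subseteq> \<Lambda>" "infinite \<Lambda>1"
    and Y1: "\<forall>y\<in>Y. \<forall>n\<in>\<Lambda>1. \<forall>m\<in>\<Lambda>1. \<bar>blinfun_apply y (e n) - blinfun_apply y (e m)\<bar> \<le> \<delta>"
    using almost_constant_on_subset[OF Y \<Lambda> \<delta>] by blast
  obtain n m where nm: "n \<in> \<Lambda>1" "m \<in> \<Lambda>1" "n < m"
    and small: "blinfun_apply (blinfun_apply H (es n)) (e m) \<le> 1 / 4"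
    using small_entry[OF condC \<Lambda>1(2), of "1/4" H] by auto
  have "infinite (\<Lambda>1 - {..m})" using \<Lambda>1(2) by simp
  moreover have "bounded_linear (\<lambda>w. blinfun_apply (blinfun_apply H w) (e n - e m))"
    by (intro bounded_linear_compose[OF blinfun.bounded_linear_left] blinfun.bounded_linear_right)
  ultimately obtain \<Lambda>' where "\<Lambda>' \<subseteq> \<Lambda>1 - {..m}" "infinite \<Lambda>'"
    and "\<And>w. (\<And>i. i \<notin> \<Lambda>' \<Longrightarrow> blinfun_apply w (e i) = 0) \<Longrightarrow>
      \<bar>blinfun_apply (blinfun_apply H w) (e n - e m)\<bar> \<le> \<delta> * norm w"
    using functional_small_on_subset[OF condC _ \<delta>] by blast
  moreover have "blinfun_apply (blinfun_apply H (es n)) (e n) \<ge> 1 / 2"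
    using diag nm \<Lambda>1 by blast
  ultimately show ?thesis
    using nm \<Lambda>1 Y1 small
    by (intro exI[of _ n] exI[of _ m] exI[of _ \<Lambda>']) (auto simp: blinfun.diff_right)
qed

text \<open>Iterating the step works because the index sets decrease: all later \<open>n j\<close>
  lie in the set fixed at stage \<open>k\<close>, where the last estimate holds, while the images of
  the earlier \<open>es (n j)\<close> have been collected in \<open>Y\<close>.\<close>

lemma test_vectors:
  fixes H :: "('a \<Rightarrow>\<^sub>L real) \<Rightarrow>\<^sub>L ('a \<Rightarrow>\<^sub>L real)" and \<delta> :: "nat \<Rightarrow> real"
  assumes condC: "condition_C e es" and \<delta>: "\<And>k. \<delta> k > 0"
    and diag: "infinite {i. blinfun_apply (blinfun_apply H (es i)) (e i) \<ge> 1 / 2}"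
  shows "\<exists>n m. strict_mono n \<and> strict_mono m \<and>
    (\<forall>k. blinfun_apply (blinfun_apply H (es (n k))) (e (n k) - e (m k)) \<ge> 1 / 4) \<and>
    (\<forall>k. \<forall>j<k. \<bar>blinfun_apply (blinfun_apply H (es (n j))) (e (n k) - e (m k))\<bar> \<le> \<delta> k) \<and>
    (\<forall>k w. (\<forall>i. i \<notin> n ` {k<..} \<longrightarrow> blinfun_apply w (e i) = 0) \<longrightarrow>
      \<bar>blinfun_apply (blinfun_apply H w) (e (n k) - e (m k))\<bar> \<le> \<delta> k * norm w)"
proof -
  define D where "D = {i. blinfun_apply (blinfun_apply H (es i)) (e i) \<ge> 1 / 2}"
  \<comment> \<open>A state consists of the remaining indices, the images under \<open>H\<close> of
    the vectors chosen so far, and the pair chosen last; the initial pair is a dummy.\<close>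
  define P :: "nat set \<times> ('a \<Rightarrow>\<^sub>L real) set \<times> nat \<times> nat \<Rightarrow> bool"
    where "P = (\<lambda>(\<Lambda>, Y, n, m). infinite \<Lambda> \<and> \<Lambda> \<subseteq> D \<and> finite Y)"
  define Q :: "nat \<Rightarrow> nat set \<times> ('a \<Rightarrow>\<^sub>L real) set \<times> nat \<times> nat \<Rightarrow>
      nat set \<times> ('a \<Rightarrow>\<^sub>L real) set \<times> nat \<times> nat \<Rightarrow> bool"
    where "Q k = (\<lambda>(\<Lambda>, Y, _, _) (\<Lambda>', Y', n, m). n \<in> \<Lambda> \<and> m \<in> \<Lambda> \<and> n < m \<and> \<Lambda>' \<subseteq> \<Lambda> \<and>
      (\<forall>i\<in>\<Lambda>'. m < i) \<and> blinfun_apply (blinfun_apply H (es n)) (e n - e m) \<ge> 1 / 4 \<and>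
      (\<forall>y\<in>Y. \<bar>blinfun_apply y (e n - e m)\<bar> \<le> \<delta> k) \<and>
      (\<forall>w. (\<forall>i. i \<notin> \<Lambda>' \<longrightarrow> blinfun_apply w (e i) = 0) \<longrightarrow>
        \<bar>blinfun_apply (blinfun_apply H w) (e n - e m)\<bar> \<le> \<delta> k * norm w) \<and>
      Y' = insert (blinfun_apply H (es n)) Y)" for k
  have "\<exists>f. \<forall>k. P (f k) \<and> Q k (f k) (f (Suc k))"
  proof (rule dependent_nat_choice)
    show "\<exists>s. P s" using diag by (intro exI[of _ "(D, {}, 0, 0)"]) (simp add: P_def D_def)
    fix s k assume "P s"
    then obtain \<Lambda> Y n0 m0 where s: "s = (\<Lambda>, Y, n0, m0)" and \<Lambda>: "infinite \<Lambda>" "\<Lambda> \<subseteq> D" and Y: "finite Y"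
      by (auto simp: P_def)
    have "\<forall>i\<in>\<Lambda>. blinfun_apply (blinfun_apply H (es i)) (e i) \<ge> 1 / 2"
      using \<Lambda>(2) by (auto simp: D_def)
    from next_test_vector[OF condC \<Lambda>(1) \<delta>[of k] Y this]
    obtain n m \<Lambda>' where *: "n \<in> \<Lambda> \<and> m \<in> \<Lambda> \<and> n < m \<and> \<Lambda>' \<subseteq> \<Lambda> \<and> infinite \<Lambda>' \<and> (\<forall>i\<in>\<Lambda>'. m < i) \<and>
      blinfun_apply (blinfun_apply H (es n)) (e n - e m) \<ge> 1 / 4 \<and>
      (\<forall>y\<in>Y. \<bar>blinfun_apply y (e n - e m)\<bar> \<le> \<delta> k) \<and>
      (\<forall>w. (\<forall>i. i \<notin> \<Lambda>' \<longrightarrow> blinfun_apply w (e i) = 0) \<longrightarrow>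
        \<bar>blinfun_apply (blinfun_apply H w) (e n - e m)\<bar> \<le> \<delta> k * norm w)"
      by (elim exE) (rule that)
    show "\<exists>s'. P s' \<and> Q k s s'"
      by (rule exI[of _ "(\<Lambda>', insert (blinfun_apply H (es n)) Y, n, m)"])
        (use * Y subset_trans[OF _ \<Lambda>(2), of \<Lambda>'] in \<open>simp add: P_def Q_def s\<close>)
  qed
  then obtain f where f: "\<And>k. Q k (f k) (f (Suc k))" by blast
  \<comment> \<open>\<open>L k\<close> and \<open>Y k\<close> belong to the state before step
    \<open>k\<close>, but the pair chosen in step \<open>k\<close> is stored in the state after it,
    hence \<open>Suc k\<close> for \<open>n\<close> and \<open>m\<close>.\<close>
  define L where "L k = fst (f k)" for k
  define Y where "Y k = fst (snd (f k))" for k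
  define n where "n k = fst (snd (snd (f (Suc k))))" for k
  define m where "m k = snd (snd (snd (f (Suc k))))" for k
  have *: "n k \<in> L k \<and> m k \<in> L k \<and> n k < m k \<and> L (Suc k) \<subseteq> L k \<and>
      (\<forall>i\<in>L (Suc k). m k < i) \<and> blinfun_apply (blinfun_apply H (es (n k))) (e (n k) - e (m k)) \<ge> 1 / 4 \<and>
      (\<forall>y\<in>Y k. \<bar>blinfun_apply y (e (n k) - e (m k))\<bar> \<le> \<delta> k) \<and>
      (\<forall>w. (\<forall>i. i \<notin> L (Suc k) \<longrightarrow> blinfun_apply w (e i) = 0) \<longrightarrow>
        \<bar>blinfun_apply (blinfun_apply H w) (e (n k) - e (m k))\<bar> \<le> \<delta> k * norm w) \<and>
      Y (Suc k) = insert (blinfun_apply H (es (n k))) (Y k)" for k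
    using f[of k] unfolding Q_def L_def Y_def n_def m_def case_prod_beta .
  have L: "L k \<subseteq> L j" if "j \<le> k" for j k
    using * lift_Suc_antimono_le[of L j k] that by auto
  have Y: "Y j \<subseteq> Y k" if "j \<le> k" for j k
    using * lift_Suc_mono_le[of Y j k] that by blast
  have n_L: "n j \<in> L (Suc k)" if "k < j" for j k
    using *[of j] L[of "Suc k" j] that by auto
  have H_in_Y: "blinfun_apply H (es (n j)) \<in> Y k" if "j < k" for j k
    using *[of j] Y[of "Suc j" k] that by auto
  have nm: "n k < m k" "m k < n (Suc k)" for k
    using *[of k] n_L[of k "Suc k"] by auto
  show ?thesis
  proof (rule exI[of _ n], rule exI[of _ m], intro conjI allI impI)
    show "strict_mono n"
      unfolding strict_mono_Suc_iff using nm less_trans by blast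
    show "strict_mono m"
      unfolding strict_mono_Suc_iff using nm less_trans by blast
    show "blinfun_apply (blinfun_apply H (es (n k))) (e (n k) - e (m k)) \<ge> 1 / 4" for k
      using *[of k] by blast
    show "\<bar>blinfun_apply (blinfun_apply H (es (n j))) (e (n k) - e (m k))\<bar> \<le> \<delta> k" if "j < k" for j k
      using *[of k] H_in_Y[OF that] by blast
    show "\<bar>blinfun_apply (blinfun_apply H w) (e (n k) - e (m k))\<bar> \<le> \<delta> k * norm w"
      if "\<forall>i. i \<notin> n ` {k<..} \<longrightarrow> blinfun_apply w (e i) = 0" for k w
    proof -
      have "n ` {k<..} \<subseteq> L (Suc k)" using n_L by auto
      then have "\<forall>i. i \<notin> L (Suc k) \<longrightarrow> blinfun_apply w (e i) = 0" using that by blast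
      then show ?thesis using *[of k] by blast
    qed
  qed
qed

section \<open>Factoring the identity through \<open>H\<close>\<close>

text \<open>\<open>N\<close> is \<open>V o\<^sub>L L\<close>, where \<open>V\<close> is a left
  inverse of \<open>L o\<^sub>L H o\<^sub>L M\<close>. The constant is the product of
  \<open>K_s\<close> for \<open>M\<close>, \<open>8 * K_u es * K\<close> for \<open>L\<close> with
  \<open>K = K_u es * K_s e es\<close>, and 2 for \<open>V\<close>.\<close>

lemma factor_identity:
  fixes H :: "('a \<Rightarrow>\<^sub>L real) \<Rightarrow>\<^sub>L ('a \<Rightarrow>\<^sub>L real)"
  assumes condC: "condition_C e es"
    and diag: "infinite {i. blinfun_apply (blinfun_apply H (es i)) (e i) \<ge> 1 / 2}"
  obtains M N :: "('a \<Rightarrow>\<^sub>L real) \<Rightarrow>\<^sub>L ('a \<Rightarrow>\<^sub>L real)"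
  where "N o\<^sub>L H o\<^sub>L M = id_blinfun"
    and "norm M * norm N \<le> 16 * K_u es ^ 2 * K_s e es ^ 2"
proof -
  define K where "K = K_u es * K_s e es"
  have K: "K \<ge> 1" using mult_mono[OF K_u_ge_1 K_s_ge_1] K_u_ge_1 by (simp add: K_def)
  \<comment> \<open>In coordinate \<open>k\<close> the earlier columns contribute at most
    \<open>k * \<delta> k * norm x\<close> and the tail at most
    \<open>K * \<delta> k * norm x\<close>. Division by \<open>d k \<ge> 1/4\<close> leaves
    \<open>norm x / 4 * (1/2) ^ k\<close>, which sums to \<open>norm x / 2\<close>.\<close>
  define \<delta> where "\<delta> k = (1/2) ^ k / (16 * (real k + K))" for k
  have \<delta>: "\<delta> k > 0" for k using K by (simp add: \<delta>_def)
  obtain n m where n: "strict_mono n" and m: "strict_mono m"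
    and d_ge: "\<forall>k. blinfun_apply (blinfun_apply H (es (n k))) (e (n k) - e (m k)) \<ge> 1 / 4"
    and before: "\<forall>k. \<forall>j<k. \<bar>blinfun_apply (blinfun_apply H (es (n j))) (e (n k) - e (m k))\<bar> \<le> \<delta> k"
    and after: "\<forall>k w. (\<forall>i. i \<notin> n ` {k<..} \<longrightarrow> blinfun_apply w (e i) = 0) \<longrightarrow>
      \<bar>blinfun_apply (blinfun_apply H w) (e (n k) - e (m k))\<bar> \<le> \<delta> k * norm w"
    using test_vectors[OF condC _ diag, of \<delta>, OF \<delta>] by (elim exE conjE) (rule that)
  define d where "d k = blinfun_apply (blinfun_apply H (es (n k))) (e (n k) - e (m k))" for k
  have d: "d k \<ge> 1/4" for k using d_ge by (simp add: d_def)
  obtain M :: "('a \<Rightarrow>\<^sub>L real) \<Rightarrow>\<^sub>L ('a \<Rightarrow>\<^sub>L real)"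
    where M: "\<And>y k. blinfun_apply (blinfun_apply M y) (e (n k)) = blinfun_apply y (e k)"
      "\<And>y i. i \<notin> range n \<Longrightarrow> blinfun_apply (blinfun_apply M y) (e i) = 0"
      "norm M \<le> K_s e es"
    using spread[OF n] by blast
  obtain L :: "('a \<Rightarrow>\<^sub>L real) \<Rightarrow>\<^sub>L ('a \<Rightarrow>\<^sub>L real)"
    where L: "\<And>y k. blinfun_apply (blinfun_apply L y) (e k) = blinfun_apply y (e (n k) - e (m k)) / d k"
    and nL: "norm L \<le> 8 * K_u es * K"
  proof (rule blinfun_of_coords)
    show "linear (\<lambda>y. blinfun_apply y (e (n k) - e (m k)) / d k)" for k
      by (rule linearI) (simp_all add: blinfun.add_left blinfun.scaleR_left add_divide_distrib)
    show "0 \<le> 8 * K_u es * K" using K K_u_ge_1 by simp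
    fix y :: "'a \<Rightarrow>\<^sub>L real"
    obtain u where u: "\<And>k. blinfun_apply u (e k) = blinfun_apply y (e (n k))" "norm u \<le> K * norm y"
      using compress[OF n, of y, folded K_def] by blast
    obtain v where v: "\<And>k. blinfun_apply v (e k) = blinfun_apply y (e (m k))" "norm v \<le> K * norm y"
      using compress[OF m, of y, folded K_def] by blast
    \<comment> \<open>The factor 8 in the bound for \<open>L\<close> is this 4 times 2, one for each
      of the compressions along \<open>n\<close> and \<open>m\<close>.\<close>
    have "\<bar>1 / d k\<bar> \<le> 4" for k using d[of k] by (simp add: divide_le_eq)
    then obtain z where z: "\<And>k. blinfun_apply z (e k) = 1 / d k * blinfun_apply (u - v) (e k)"
      and nz: "norm z \<le> K_u es * 4 * norm (u - v)"
      by (rule multiplier[of _ _ "u - v"]) (rule that)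
    have "norm (u - v) \<le> 2 * (K * norm y)"
      using norm_triangle_ineq4[of u v] u(2) v(2) by linarith
    then have "K_u es * 4 * norm (u - v) \<le> K_u es * 4 * (2 * (K * norm y))"
      using K_u_ge_1 by (intro mult_left_mono) auto
    then have "norm z \<le> 8 * K_u es * K * norm y" using nz by (simp add: mult_ac)
    moreover have "blinfun_apply z (e k) = blinfun_apply y (e (n k) - e (m k)) / d k" for k
      by (simp add: z u v blinfun.bilinear_simps)
    ultimately show "\<exists>z. (\<forall>k. blinfun_apply z (e k) = blinfun_apply y (e (n k) - e (m k)) / d k) \<and>
        norm z \<le> 8 * K_u es * K * norm y"
      by blast
  qed (rule that)
  have near: "norm (blinfun_apply (L o\<^sub>L H o\<^sub>L M) x - x) \<le> 1 / 2 * norm x" for x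
  proof -
    have "\<bar>blinfun_apply (blinfun_apply (L o\<^sub>L H o\<^sub>L M) x - x) (e k)\<bar> \<le> norm x / 4 * (1/2) ^ k" for k
    proof -
      let ?b = "e (n k) - e (m k)"
      define \<gamma> :: "nat \<Rightarrow> real" where "\<gamma> i = (if i \<in> n ` {k<..} then 1 else 0)" for i
      obtain w where w: "\<And>i. blinfun_apply w (e i) = \<gamma> i * blinfun_apply (blinfun_apply M x) (e i)"
        and nw: "norm w \<le> K_u es * 1 * norm (blinfun_apply M x)"
        by (rule multiplier[of \<gamma> 1 "blinfun_apply M x"]) (simp add: \<gamma>_def, rule that)
      have "norm (blinfun_apply M x) \<le> K_s e es * norm x"
        by (rule order_trans[OF norm_blinfun]) (use M(3) in \<open>auto intro: mult_right_mono\<close>)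
      then have "K_u es * norm (blinfun_apply M x) \<le> K_u es * (K_s e es * norm x)"
        using K_u_ge_1 by (intro mult_left_mono) auto
      then have nw: "norm w \<le> K * norm x" using nw by (simp add: K_def mult_ac)
      \<comment> \<open>\<open>H\<close> need not commute with weak-star series, so
        \<open>M x\<close> is split into a finite head, on which \<open>H\<close> acts term by term,
        and a tail \<open>w\<close> treated as one vector supported on the later indices.\<close>
      have Mx: "blinfun_apply M x = (\<Sum>j<Suc k. blinfun_apply x (e j) *\<^sub>R es (n j)) + w"
      proof (rule coord_eqI)
        fix i
        show "blinfun_apply (blinfun_apply M x) (e i) =
          blinfun_apply ((\<Sum>j<Suc k. blinfun_apply x (e j) *\<^sub>R es (n j)) + w) (e i)"
        proof (cases "i \<in> range n")
          case True
          then obtain l where l: "i = n l" by blast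
          have inj: "n a = n b \<longleftrightarrow> a = b" for a b using n by (simp add: strict_mono_eq)
          have "(\<Sum>j<Suc k. blinfun_apply x (e j) * blinfun_apply (es (n j)) (e i)) =
              (\<Sum>j<Suc k. if j = l then blinfun_apply x (e j) else 0)"
            by (intro sum.cong) (auto simp: biorth l inj)
          also have "\<dots> = (if l < Suc k then blinfun_apply x (e l) else 0)"
            by simp
          finally have "blinfun_apply ((\<Sum>j<Suc k. blinfun_apply x (e j) *\<^sub>R es (n j)) + w) (e i) =
              (if l < Suc k then blinfun_apply x (e l) else 0) + \<gamma> i * blinfun_apply x (e l)"
            by (simp only: blinfun.bilinear_simps w M(1) l real_scaleR_def)
          moreover have "\<gamma> i = (if l < Suc k then 0 else 1)"
            by (auto simp: \<gamma>_def l inj image_iff)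
          ultimately show ?thesis by (simp add: l M(1))
        next
          case False
          then have "blinfun_apply (es (n j)) (e i) = 0" for j by (auto simp: biorth)
          then show ?thesis using False by (simp add: blinfun.bilinear_simps w M(2) del: sum.lessThan_Suc)
        qed
      qed
      \<comment> \<open>\<open>R\<close> collects everything off the diagonal; the term
        \<open>j = k\<close> of the head is the diagonal part and is split off.\<close>
      define R where "R = (\<Sum>j<k. blinfun_apply x (e j) * blinfun_apply (blinfun_apply H (es (n j))) ?b)
        + blinfun_apply (blinfun_apply H w) ?b"
      have HMx: "blinfun_apply (blinfun_apply H (blinfun_apply M x)) ?b = R + blinfun_apply x (e k) * d k"
        by (simp add: Mx R_def d_def blinfun.add_left blinfun.add_right blinfun.sum_left blinfun.sum_right
            blinfun.scaleR_left blinfun.scaleR_right)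
      have "\<bar>\<Sum>j<k. blinfun_apply x (e j) * blinfun_apply (blinfun_apply H (es (n j))) ?b\<bar>
          \<le> (\<Sum>j<k. norm x * \<delta> k)"
        by (rule order_trans[OF sum_abs], rule sum_mono)
          (auto simp: abs_mult intro!: mult_mono abs_coord_le before[rule_format])
      moreover have "\<bar>blinfun_apply (blinfun_apply H w) ?b\<bar> \<le> \<delta> k * norm w"
        by (rule after[rule_format]) (simp add: w \<gamma>_def)
      moreover have "\<delta> k * norm w \<le> \<delta> k * (K * norm x)"
        using nw less_imp_le[OF \<delta>] by (rule mult_left_mono)
      ultimately have "\<bar>R\<bar> \<le> real k * (norm x * \<delta> k) + \<delta> k * (K * norm x)"
        unfolding R_def by (simp add: abs_le_iff)
      also have "\<dots> = \<delta> k * (real k + K) * norm x" by (simp add: algebra_simps)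
      also have "\<delta> k * (real k + K) = (1/2) ^ k / 16"
      proof -
        have "c / (16 * t) * t = c / 16" if "t \<noteq> 0" for c t :: real using that by simp
        moreover have "real k + K \<noteq> 0" using K by linarith
        ultimately show ?thesis unfolding \<delta>_def by blast
      qed
      finally have R: "\<bar>R\<bar> \<le> (1/2) ^ k / 16 * norm x" .
      have "blinfun_apply (blinfun_apply (L o\<^sub>L H o\<^sub>L M) x - x) (e k) = R / d k"
        using d[of k] by (simp add: blinfun.diff_left L HMx add_divide_distrib)
      also have "\<bar>R / d k\<bar> \<le> \<bar>R\<bar> / (1/4)"
      proof -
        have "d k > 0" using d[of k] by linarith
        then have "\<bar>R / d k\<bar> = \<bar>R\<bar> / d k" by simp
        also have "\<dots> \<le> \<bar>R\<bar> / (1/4)" by (rule divide_left_mono) (use d[of k] in auto)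
        finally show ?thesis .
      qed
      finally show ?thesis using R by (simp add: mult.commute)
    qed
    moreover have "summable (\<lambda>k. norm x / 4 * (1/2) ^ k)"
      by (intro summable_mult summable_geometric) simp
    ultimately have "norm (blinfun_apply (L o\<^sub>L H o\<^sub>L M) x - x) \<le> (\<Sum>k. norm x / 4 * (1/2) ^ k)"
      by (rule norm_le_suminf_coords)
    also have "\<dots> = 1 / 2 * norm x"
        using suminf_mult[of "\<lambda>k. (1/2) ^ k" "norm x / 4"] by (simp add: suminf_geometric summable_geometric)
    finally show ?thesis .
  qed
  obtain V where V: "V o\<^sub>L (L o\<^sub>L H o\<^sub>L M) = id_blinfun" and nV: "norm V \<le> 1 / (1 - 1 / 2)"
    by (rule blinfun_left_inverse_near_id[OF _ near]) (simp, rule that)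
  show thesis
  proof (rule that)
    show "(V o\<^sub>L L) o\<^sub>L H o\<^sub>L M = id_blinfun"
      unfolding V[symmetric] by (rule blinfun_eqI) simp
    have "norm (V o\<^sub>L L) \<le> norm V * norm L" by (rule norm_blinfun_compose)
    also have "\<dots> \<le> 2 * (8 * K_u es * K)" using nV nL by (intro mult_mono) auto
    finally have "norm M * norm (V o\<^sub>L L) \<le> K_s e es * (2 * (8 * K_u es * K))"
      using M(3) K_s_ge_1 by (intro mult_mono) auto
    then show "norm M * norm (V o\<^sub>L L) \<le> 16 * K_u es ^ 2 * K_s e es ^ 2"
      by (simp add: K_def power2_eq_square mult_ac)
  qed
qed

end

section \<open>Complemented copies of the space, and the theorem\<close>

text \<open>\<open>N\<close> is a left inverse of \<open>J = H o\<^sub>L M\<close>, so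
  \<open>J\<close> is bounded below and \<open>J o\<^sub>L N\<close> is a projection onto its
  range.\<close>

lemma complemented_range:
  fixes M N H :: "'b::real_normed_vector \<Rightarrow>\<^sub>L 'b"
  assumes "N o\<^sub>L H o\<^sub>L M = id_blinfun"
  shows "\<exists>Y. subspace Y \<and> closed Y \<and> Y \<subseteq> range (blinfun_apply H) \<and>
    (\<exists>J :: 'b \<Rightarrow>\<^sub>L 'b. range (blinfun_apply J) = Y \<and>
      (\<exists>c>0. \<forall>y. c * norm y \<le> norm (blinfun_apply J y))) \<and>
    (\<exists>P :: 'b \<Rightarrow>\<^sub>L 'b. P o\<^sub>L P = P \<and> range (blinfun_apply P) = Y)"
proof -
  define J where "J = H o\<^sub>L M"
  define P where "P = J o\<^sub>L N"
  have NJ: "blinfun_apply N (blinfun_apply J y) = y" for y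
    using arg_cong[OF assms, of "\<lambda>F. blinfun_apply F y"] by (simp add: J_def)
  have range_P: "range (blinfun_apply P) = range (blinfun_apply J)"
  proof
    show "range (blinfun_apply J) \<subseteq> range (blinfun_apply P)"
    proof
      fix z assume "z \<in> range (blinfun_apply J)"
      then obtain y where "z = blinfun_apply J y" by blast
      then have "z = blinfun_apply P (blinfun_apply J y)" by (simp add: P_def NJ)
      then show "z \<in> range (blinfun_apply P)" by blast
    qed
  qed (auto simp: P_def)
  \<comment> \<open>As the fixed point set of a bounded operator, the range is visibly a closed
    subspace.\<close>
  have range_fix: "range (blinfun_apply J) = {y. blinfun_apply P y = y}"
  proof
    show "{y. blinfun_apply P y = y} \<subseteq> range (blinfun_apply J)"
      using range_P by (metis (mono_tags, lifting) mem_Collect_eq rangeI subsetI)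
  qed (auto simp: P_def NJ)
  have "subspace (range (blinfun_apply J))"
    unfolding range_fix by (rule subspaceI) (auto simp: blinfun.bilinear_simps)
  moreover have "closed (range (blinfun_apply J))"
    unfolding range_fix by (intro closed_Collect_eq continuous_intros)
  moreover have "range (blinfun_apply J) \<subseteq> range (blinfun_apply H)"
    by (auto simp: J_def)
  moreover have "\<exists>c>0. \<forall>y. c * norm y \<le> norm (blinfun_apply J y)"
  proof (intro exI conjI allI)
    have pos: "norm N + 1 > 0" using norm_ge_zero[of N] by linarith
    then show "1 / (norm N + 1) > 0" by simp
    fix y
    have "norm y \<le> norm N * norm (blinfun_apply J y)"
      using norm_blinfun[of N "blinfun_apply J y"] by (simp add: NJ)
    also have "\<dots> \<le> (norm N + 1) * norm (blinfun_apply J y)"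
      by (intro mult_right_mono) auto
    finally show "1 / (norm N + 1) * norm y \<le> norm (blinfun_apply J y)"
      using pos by (simp add: pos_divide_le_eq mult.commute)
  qed
  moreover have "P o\<^sub>L P = P"
    by (rule blinfun_eqI) (simp add: P_def NJ)
  ultimately show ?thesis using range_P by blast
qed

theorem theorem1p1:
  fixes e :: "nat \<Rightarrow> 'a::banach"
    and es :: "nat \<Rightarrow> ('a \<Rightarrow>\<^sub>L real)"
    and T :: "('a \<Rightarrow>\<^sub>L real) \<Rightarrow>\<^sub>L ('a \<Rightarrow>\<^sub>L real)"
  assumes basis: "schauder_basis e"
    and e_norm: "\<forall>j. norm (e j) = 1"
    and biorth: "\<forall>i j. blinfun_apply (es j) (e i) = (if i = j then 1 else 0)"
    and es_norm: "\<forall>j. norm (es j) = 1"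
    and wstar: "wstar_schauder_basis e es"
    and subsym: "subsymmetric e es"
    and condC: "condition_C e es"
  shows "\<exists>H \<in> {T, id_blinfun - T}.
           (\<exists>M N :: ('a \<Rightarrow>\<^sub>L real) \<Rightarrow>\<^sub>L ('a \<Rightarrow>\<^sub>L real).
              N o\<^sub>L H o\<^sub>L M = id_blinfun \<and>
              norm M * norm N \<le> 48 * K_u es ^ 7 * K_s e es ^ 4) \<and>
           (\<exists>Y :: ('a \<Rightarrow>\<^sub>L real) set. subspace Y \<and> closed Y \<and> Y \<subseteq> range (blinfun_apply H) \<and>
              (\<exists>J :: ('a \<Rightarrow>\<^sub>L real) \<Rightarrow>\<^sub>L ('a \<Rightarrow>\<^sub>L real). range (blinfun_apply J) = Y \<and>
                 (\<exists>c>0. \<forall>y. c * norm y \<le> norm (blinfun_apply J y))) \<and>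
              (\<exists>P :: ('a \<Rightarrow>\<^sub>L real) \<Rightarrow>\<^sub>L ('a \<Rightarrow>\<^sub>L real). P o\<^sub>L P = P \<and> range (blinfun_apply P) = Y))"
proof -
  interpret subsymmetric_wstar_basis e es
    by (rule subsymmetric_wstar_basis.intro)
      (rule e_norm[rule_format] biorth[rule_format] es_norm[rule_format] wstar subsym)+
  let ?D = "\<lambda>H :: ('a \<Rightarrow>\<^sub>L real) \<Rightarrow>\<^sub>L ('a \<Rightarrow>\<^sub>L real). {i. blinfun_apply (blinfun_apply H (es i)) (e i) \<ge> 1 / 2}"
  \<comment> \<open>The diagonal entries of \<open>T\<close> and \<open>id_blinfun - T\<close> at
    \<open>i\<close> add up to 1, so one of them is at least \<open>1/2\<close>.\<close>
  have "i \<in> ?D T \<union> ?D (id_blinfun - T)" for i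
    using biorth by (auto simp: blinfun.diff_left)
  then have "?D T \<union> ?D (id_blinfun - T) = UNIV" by blast
  then have "infinite (?D T \<union> ?D (id_blinfun - T))" by simp
  then obtain H where H: "H \<in> {T, id_blinfun - T}" and inf: "infinite (?D H)" by blast
  obtain M N :: "('a \<Rightarrow>\<^sub>L real) \<Rightarrow>\<^sub>L ('a \<Rightarrow>\<^sub>L real)" where NHM: "N o\<^sub>L H o\<^sub>L M = id_blinfun"
    and le: "norm M * norm N \<le> 16 * K_u es ^ 2 * K_s e es ^ 2"
    by (rule factor_identity[OF condC inf]) (rule that)
  \<comment> \<open>Both constants are at least 1, so raising the exponents only weakens the
    bound.\<close>
  have "16 * K_u es ^ 2 * K_s e es ^ 2 \<le> 48 * K_u es ^ 7 * K_s e es ^ 4"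
    using K_u_ge_1 K_s_ge_1 by (intro mult_mono power_increasing) auto
  then have "norm M * norm N \<le> 48 * K_u es ^ 7 * K_s e es ^ 4"
    using le by linarith
  with NHM have "\<exists>M N :: ('a \<Rightarrow>\<^sub>L real) \<Rightarrow>\<^sub>L ('a \<Rightarrow>\<^sub>L real).
      N o\<^sub>L H o\<^sub>L M = id_blinfun \<and> norm M * norm N \<le> 48 * K_u es ^ 7 * K_s e es ^ 4"
    by blast
  then show ?thesis
    using complemented_range[OF NHM] by (intro bexI[OF _ H] conjI)
qed

end
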